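(* Let $\mathfrak g$ be a (finite-dimensional) reductive Lie algebra over an algebraically closed field of characteristic zero, let $e\in\mathfrak g$ satisfy $(\operatorname{ad} e)^3=0$, and put $D=(\operatorname{ad} e)^2$. Let $\mathfrak g_D=(\mathfrak g,[\ ,\,]'_D)$ be the vector space $\mathfrak g$ with the Lie bracket $[\ ,\,]'_D$. Then $\operatorname{ind}\mathfrak g_D=\dim\mathfrak g^e$ and $\mathfrak z(\mathfrak g_D)=\mathfrak g^e$.
   Context: $[x,y]'_D=D([x,y])-[Dx,y]-[x,Dy]$ is the derived operation of the Lie bracket of $\mathfrak g$ with respect to $D$; under the stated hypotheses it is a Lie bracket on the vector space $\mathfrak g$. $\mathfrak g^e=\{x\in\mathfrak g\mid[e,x]=0\}$ is the centraliser of $e$ in $\mathfrak g$ (with respect to the original bracket), and $\mathfrak z(\mathfrak g_D)$ is the centre of the Lie algebra $\mathfrak g_D$. The index of a finite-dimensional Lie algebra $\mathfrak q$ is $\operatorname{ind}\mathfrak q=\min_{\xi\in\mathfrak q^*}\dim\mathfrak q^\xi$, where $\mathfrak q^\xi=\{x\in\mathfrak q\mid\xi([x,y])=0\ \forall y\in\mathfrak q\}$. *)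

theory Defs
  imports Main "HOL-Computational_Algebra.Polynomial"
begin

locale lie_algebra = vector_space scale
  for scale :: "'k::field \<Rightarrow> 'g::ab_group_add \<Rightarrow> 'g" +
  fixes bracket :: "'g \<Rightarrow> 'g \<Rightarrow> 'g"
  assumes bracket_add_left: "bracket (x + y) z = bracket x z + bracket y z"
    and bracket_add_right: "bracket x (y + z) = bracket x y + bracket x z"
    and bracket_scale_left: "bracket (scale c x) y = scale c (bracket x y)"
    and bracket_scale_right: "bracket x (scale c y) = scale c (bracket x y)"
    and bracket_self: "bracket x x = 0"
    and jacobi: "bracket x (bracket y z) + bracket y (bracket z x) + bracket z (bracket x y) = 0"
begin

definition ad :: "'g \<Rightarrow> 'g \<Rightarrow> 'g"
  where "ad x = (\<lambda>y. bracket x y)"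

definition centraliser :: "'g \<Rightarrow> 'g set"
  where "centraliser e = {x. bracket e x = 0}"

definition centre :: "'g set"
  where "centre = {x. \<forall>y. bracket x y = 0}"

definition ideal :: "'g set \<Rightarrow> bool"
  where "ideal I \<longleftrightarrow> subspace I \<and> (\<forall>x. \<forall>y\<in>I. bracket x y \<in> I)"

text \<open>
  A Lie algebra is reductive if its adjoint representation is semisimple (the definition of
  Bourbaki), that is, every subrepresentation has a complementary subrepresentation.
  The subrepresentations of the adjoint representation are the ideals.
\<close>

definition reductive :: bool
  where "reductive \<longleftrightarrow>
    (\<forall>I. ideal I \<longrightarrow>
      (\<exists>J. ideal J \<and> I \<inter> J = {0} \<and> {x + y | x y. x \<in> I \<and> y \<in> J} = UNIV))"

definition stabiliser :: "('g \<Rightarrow> 'k) \<Rightarrow> 'g set"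
  where "stabiliser \<xi> = {x. \<forall>y. \<xi> (bracket x y) = 0}"

text \<open>
  The infimum is taken in \<^typ>\<open>nat\<close> over a nonempty set (the zero functional is linear),
  so it is a minimum.
\<close>

definition index :: nat
  where "index = (INF \<xi>\<in>{\<xi>. Vector_Spaces.linear scale (*) \<xi>}. dim (stabiliser \<xi>))"

end

definition derived_bracket :: "('g::ab_group_add \<Rightarrow> 'g \<Rightarrow> 'g) \<Rightarrow> ('g \<Rightarrow> 'g) \<Rightarrow> 'g \<Rightarrow> 'g \<Rightarrow> 'g"
  where "derived_bracket bracket D x y = D (bracket x y) - bracket (D x) y - bracket x (D y)"

text \<open>
  The derived bracket with respect to \<open>(ad e)\<^sup>2\<close> is a Lie bracket if \<open>(ad e)\<^sup>3 = 0\<close>, so that the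
  notions of the locale apply to it.
\<close>

context lie_algebra
begin

lemma bracket_zero_left [simp]: "bracket 0 x = 0"
  using bracket_add_left[of 0 0 x] by simp

lemma bracket_zero_right [simp]: "bracket x 0 = 0"
  using bracket_add_right[of x 0 0] by simp

lemma bracket_anti: "bracket y x = - bracket x y"
proof -
  have "bracket (x + y) (x + y) = 0" by (rule bracket_self)
  then have "bracket x y + bracket y x = 0"
    unfolding bracket_add_left bracket_add_right by (simp add: bracket_self add.commute)
  then show ?thesis by (metis add.inverse_unique)
qed

lemma bracket_minus_left: "bracket (- x) y = - bracket x y"
  using bracket_add_left[of x "- x" y] by (simp add: minus_unique)

lemma bracket_minus_right: "bracket x (- y) = - bracket x y"
  using bracket_add_right[of x y "- y"] by (simp add: minus_unique)

lemma bracket_leibniz: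
  "bracket e (bracket x y) = bracket (bracket e x) y + bracket x (bracket e y)"
proof -
  have "bracket y (bracket e x) = - bracket (bracket e x) y" by (rule bracket_anti)
  moreover have "bracket x (bracket y e) = - bracket x (bracket e y)"
    by (metis bracket_anti bracket_minus_right)
  ultimately show ?thesis
    using jacobi[of e x y] by (simp add: algebra_simps)
qed

lemma derived_bracket_ad_square:
  "derived_bracket bracket (ad e ^^ 2) x y =
    bracket (bracket e x) (bracket e y) + bracket (bracket e x) (bracket e y)"
proof -
  have "bracket e (bracket e (bracket x y)) =
      bracket (bracket e (bracket e x)) y + bracket (bracket e x) (bracket e y)
      + (bracket (bracket e x) (bracket e y) + bracket x (bracket e (bracket e y)))"
    by (simp only: bracket_leibniz[of e x y] bracket_add_right
        bracket_leibniz[of e "bracket e x" y] bracket_leibniz[of e x "bracket e y"])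
  then show ?thesis
    by (simp add: derived_bracket_def ad_def numeral_2_eq_2)
qed

lemma lie_algebra_derived_bracket:
  assumes three: "(3::'k) \<noteq> 0" and nil: "ad e ^^ 3 = (\<lambda>x. 0)"
  shows "lie_algebra scale (derived_bracket bracket (ad e ^^ 2))"
proof
  let ?B = "derived_bracket bracket (ad e ^^ 2)"
  have n: "bracket e (bracket e (bracket e x)) = 0" for x
    using fun_cong[OF nil, of x] by (simp add: ad_def numeral_3_eq_3)
  have key: "bracket e (bracket (bracket e x) (bracket e y)) = 0" for x y
  proof -
    let ?t = "bracket e (bracket (bracket e x) (bracket e y))"
    define p where "p = bracket (bracket e (bracket e x)) (bracket e y)"
    define q where "q = bracket (bracket e x) (bracket e (bracket e y))"
    have t: "?t = p + q"
      unfolding p_def q_def by (rule bracket_leibniz)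
    have 1: "bracket e (bracket (bracket e (bracket e x)) y) = p"
      using bracket_leibniz[of e "bracket e (bracket e x)" y] by (simp add: n p_def)
    have 2: "bracket e (bracket x (bracket e (bracket e y))) = q"
      using bracket_leibniz[of e x "bracket e (bracket e y)"] by (simp add: n q_def)
    have "bracket e (bracket e (bracket x y)) =
        bracket (bracket e (bracket e x)) y + bracket (bracket e x) (bracket e y)
        + (bracket (bracket e x) (bracket e y) + bracket x (bracket e (bracket e y)))"
      by (simp only: bracket_leibniz[of e x y] bracket_add_right
          bracket_leibniz[of e "bracket e x" y] bracket_leibniz[of e x "bracket e y"])
    then have "bracket e (bracket e (bracket e (bracket x y))) = p + ?t + (?t + q)"
      by (simp only: bracket_add_right 1 2)
    then have "?t + ?t + ?t = 0"
      by (simp add: n t algebra_simps)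
    moreover have "scale 3 ?t = ?t + ?t + ?t"
      using scale_left_distrib[of 2 1 ?t] scale_left_distrib[of 1 1 ?t] by simp
    ultimately show ?thesis using three by simp
  qed
  show "?B x (?B y z) + ?B y (?B z x) + ?B z (?B x y) = 0" for x y z
    by (simp add: derived_bracket_ad_square bracket_add_right key)
qed (simp_all add: derived_bracket_ad_square bracket_add_left bracket_add_right
      bracket_scale_left bracket_scale_right bracket_self scale_right_distrib algebra_simps)

end

end

theory Submission
  imports Defs
begin

text \<open>
  For \<open>D = (ad e)\<^sup>2\<close> the derived bracket of \<open>x\<close> and \<open>y\<close> is
  \<open>2 [[e, x], [e, y]]\<close>. Hence the centraliser of \<open>e\<close> lies in the centre of the derived algebra, and
  the centre lies in the stabiliser of every functional. Both assertions therefore follow from a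
  single linear functional \<open>\<xi>\<close> for which \<open>\<xi> [[e, x], [e, y]] = 0\<close> for all \<open>y\<close> forces \<open>[e, x] = 0\<close>
  (\<open>exists_functional_with_stabiliser_centraliser\<close>).

  Such a functional is \<open>\<xi> = killing f\<close>, where \<open>[e, [e, f]] = - 2 e\<close> modulo the centre, that is, \<open>e\<close>, \<open>f\<close> and
  \<open>h = [e, f]\<close> are an \<open>sl\<^sub>2\<close>-triple up to the relation \<open>[h, f] = - 2 f\<close>. Invariance of the Killing form turns
  the condition on \<open>x\<close> into the statement that \<open>[e, [f, [e, x]]]\<close> is in the radical of the form; if
  it vanishes, so does \<open>[e, x]\<close>, by a weight argument (\<open>ef_injective_on_image\<close>).

  Two facts about reductive algebras enter. The radical of the Killing form is the centre
  (\<open>radical_eq_centre\<close>): the brackets with elements of the radical are ad-nilpotent by the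
  trace argument of Cartan's criterion, so by Engel's theorem they generate an ideal with nonzero
  invariants in every nonzero ideal; semisimplicity of the adjoint representation makes such an
  ideal central, and central brackets vanish. Second, the image of \<open>(ad e)\<^sup>2\<close> contains \<open>e\<close> modulo the
  centre (\<open>double_bracket_regular\<close>), as in the proof of the Jacobson-Morozov theorem: by
  nondegeneracy it is enough that every \<open>w\<close> with \<open>[e, [e, w]]\<close> central is orthogonal to \<open>e\<close>, and for such
  \<open>w\<close> the operator \<open>ad w ad e\<close> is nilpotent.
\<close>


section \<open>The trace of an endomorphism\<close>

locale linear_operators = vector_space scale
  for scale :: "'a::field \<Rightarrow> 'b::ab_group_add \<Rightarrow> 'b"
begin

sublocale endo: vector_space_pair scale scale ..

abbreviation endo :: "('b \<Rightarrow> 'b) \<Rightarrow> bool"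
  where "endo f \<equiv> Vector_Spaces.linear scale scale f"

lemma endoI:
  assumes "\<And>x y. f (x + y) = f x + f y" and "\<And>c x. f (scale c x) = scale c (f x)"
  shows "endo f"
  using assms vector_space_axioms by (simp add: Vector_Spaces.linear_iff)

definition trace :: "'b set \<Rightarrow> ('b \<Rightarrow> 'b) \<Rightarrow> 'a"
  where "trace C f = (\<Sum>b\<in>C. representation C (f b) b)"

text \<open>
  If \<open>f\<close> maps the span of \<open>C\<close> into the smaller span of \<open>C'\<close>, then the vectors outside the span of
  \<open>C'\<close> do not contribute to the trace. For equal spans this says that the trace does not
  depend on the basis. The reason is that the trace is \<open>tr (i \<circ> f)\<close> for the inclusion \<open>i\<close> of the
  small span, which equals \<open>tr (f \<circ> i)\<close>.
\<close>

lemma trace_restrict: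
  assumes f: "endo f" and C: "finite C" "independent C" and C': "finite C'" "independent C'"
    and img: "f ` span C \<subseteq> span C'" and sub: "span C' \<subseteq> span C"
  shows "trace C f = trace C' f"
proof -
  have fb: "f b = (\<Sum>c\<in>C'. scale (representation C' (f b) c) c)" if "b \<in> C" for b
    using that img by (intro sum_representation_eq[symmetric] C') (auto intro: span_base)
  have c: "c = (\<Sum>b\<in>C. scale (representation C c b) b)" if "c \<in> C'" for c
    using that sub by (intro sum_representation_eq[symmetric] C) (auto intro: span_base)
  have inC: "c \<in> span C" if "c \<in> C'" for c using that sub by (auto intro: span_base)
  have "trace C f =
      (\<Sum>b\<in>C. representation C (\<Sum>c\<in>C'. scale (representation C' (f b) c) c) b)"
    unfolding trace_def using fb by (intro sum.cong) auto
  also have "\<dots> = (\<Sum>b\<in>C. \<Sum>c\<in>C'. representation C' (f b) c * representation C c b)"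
    by (intro sum.cong refl)
      (simp add: representation_sum[OF C(2)] representation_scale[OF C(2)] inC span_scale)
  also have "\<dots> = (\<Sum>c\<in>C'. \<Sum>b\<in>C. representation C c b * representation C' (f b) c)"
    by (subst sum.swap) (simp add: mult.commute)
  also have "\<dots> = (\<Sum>c\<in>C'. representation C' (f (\<Sum>b\<in>C. scale (representation C c b) b)) c)"
  proof (intro sum.cong refl)
    fix c
    have "f b \<in> span C'" if "b \<in> C" for b using that img by (auto intro: span_base)
    then show "(\<Sum>b\<in>C. representation C c b * representation C' (f b) c) =
        representation C' (f (\<Sum>b\<in>C. scale (representation C c b) b)) c"
      by (simp add: endo.linear_sum[OF f] endo.linear_scale[OF f] representation_sum[OF C'(2)]
          representation_scale[OF C'(2)] span_scale)
  qed
  also have "\<dots> = trace C' f"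
    unfolding trace_def using c by (intro sum.cong) auto
  finally show ?thesis .
qed

end

locale fd_linear_operators = linear_operators scale + finite_dimensional_vector_space scale Basis
  for scale :: "'a::field \<Rightarrow> 'b::ab_group_add \<Rightarrow> 'b" and Basis
begin

abbreviation tr :: "('b \<Rightarrow> 'b) \<Rightarrow> 'a"
  where "tr \<equiv> trace Basis"

lemma tr_basis_independent:
  assumes "endo f" "independent C" "span C = UNIV"
  shows "tr f = trace C f"
  using assms finiteI_independent finite_Basis independent_Basis span_Basis
  by (intro trace_restrict) auto

lemma tr_zero: "tr (\<lambda>x. 0) = 0"
  by (simp add: trace_def representation_zero)

lemma tr_add: "tr (\<lambda>x. f x + g x) = tr f + tr g"
  by (simp add: trace_def representation_add independent_Basis span_Basis sum.distrib)

lemma tr_diff: "tr (\<lambda>x. f x - g x) = tr f - tr g"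
  by (simp add: trace_def representation_diff independent_Basis span_Basis sum_subtractf)

lemma tr_minus: "tr (\<lambda>x. - f x) = - tr f"
  by (simp add: trace_def representation_neg independent_Basis span_Basis sum_negf)

lemma tr_scale: "tr (\<lambda>x. scale c (f x)) = c * tr f"
  by (simp add: trace_def representation_scale independent_Basis span_Basis sum_distrib_left)

lemma tr_commute:
  assumes f: "endo f" and g: "endo g"
  shows "tr (\<lambda>x. f (g x)) = tr (\<lambda>x. g (f x))"
proof -
  have expand: "tr (\<lambda>x. f (g x)) =
      (\<Sum>b\<in>Basis. \<Sum>c\<in>Basis. representation Basis (g b) c * representation Basis (f c) b)"
    if f: "endo f" for f g
  proof -
    have "g b = (\<Sum>c\<in>Basis. scale (representation Basis (g b) c) c)" for b
      by (intro sum_representation_eq[symmetric])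
        (auto simp: independent_Basis span_Basis finite_Basis)
    then have "f (g b) = (\<Sum>c\<in>Basis. scale (representation Basis (g b) c) (f c))" for b
      by (metis (mono_tags, lifting) endo.linear_sum[OF f] endo.linear_scale[OF f] sum.cong)
    then show ?thesis
      by (simp add: trace_def representation_sum representation_scale independent_Basis span_Basis)
  qed
  show ?thesis
    unfolding expand[OF f] expand[OF g]
    by (subst sum.swap) (simp add: mult.commute)
qed

end

section \<open>Generalised eigenspaces\<close>

context linear_operators
begin

text \<open>
  The generalised eigenspace of \<open>T\<close> for \<open>a\<close>, that is, the union of the kernels of the powers of
  \<open>T - a\<close>. The inductive form turns arguments on the exponent into rule inductions.
  For \<open>a = 0\<close> it consists of the vectors on which \<open>T\<close> is nilpotent.
\<close>

inductive_set gen_eig :: "('b \<Rightarrow> 'b) \<Rightarrow> 'a \<Rightarrow> 'b set" for T a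
  where zero: "0 \<in> gen_eig T a"
    | step: "T v - scale a v \<in> gen_eig T a \<Longrightarrow> v \<in> gen_eig T a"

lemma gen_eig_diff:
  assumes "endo T" "v \<in> gen_eig T a"
  shows "T v - scale a v \<in> gen_eig T a"
  using assms(2)
proof cases
  case zero
  then show ?thesis by (simp add: endo.linear_0[OF assms(1)] gen_eig.zero)
qed

lemma subspace_gen_eig:
  assumes T: "endo T"
  shows "subspace (gen_eig T a)"
proof (rule subspaceI)
  show "0 \<in> gen_eig T a" by (rule gen_eig.zero)
next
  fix u v assume "u \<in> gen_eig T a" "v \<in> gen_eig T a"
  then show "u + v \<in> gen_eig T a"
  proof (induction arbitrary: v)
    case zero
    then show ?case by simp
  next
    case (step u)
    then have "(T u - scale a u) + (T v - scale a v) \<in> gen_eig T a"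
      using gen_eig_diff[OF T] by blast
    then have "T (u + v) - scale a (u + v) \<in> gen_eig T a"
      by (simp add: endo.linear_add[OF T] scale_right_distrib algebra_simps)
    then show ?case by (rule gen_eig.step)
  qed
next
  fix c u assume "u \<in> gen_eig T a"
  then show "scale c u \<in> gen_eig T a"
  proof induction
    case zero
    then show ?case by (simp add: gen_eig.zero)
  next
    case (step u)
    have "T (scale c u) - scale a (scale c u) = scale c (T u - scale a u)"
      by (simp only: endo.linear_scale[OF T] scale_right_diff_distrib scale_left_commute)
    then have "T (scale c u) - scale a (scale c u) \<in> gen_eig T a" using step.IH by simp
    then show ?case by (rule gen_eig.step)
  qed
qed

lemma gen_eig_image:
  assumes T: "endo T" and v: "v \<in> gen_eig T a"
  shows "T v \<in> gen_eig T a"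
  using subspace_add[OF subspace_gen_eig[OF T] gen_eig_diff[OF T v]
      subspace_scale[OF subspace_gen_eig[OF T] v, of a]]
  by simp

lemma gen_eig_inj:
  assumes T: "endo T" and v: "v \<in> gen_eig T b" and "a \<noteq> b" and "T v = scale a v"
  shows "v = 0"
  using v assms(4)
proof induction
  case (step v)
  have w: "T v - scale b v = scale (a - b) v"
    by (simp add: step scale_left_diff_distrib)
  then have "T (T v - scale b v) = scale a (T v - scale b v)"
    by (simp only: endo.linear_scale[OF T] step.prems scale_left_commute)
  then show ?case using step.IH w \<open>a \<noteq> b\<close> by simp
qed simp

lemma gen_eig_surj:
  assumes T: "endo T" and w: "w \<in> gen_eig T b" and "a \<noteq> b"
  shows "\<exists>u\<in>gen_eig T b. T u - scale a u = w"
  using w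
proof induction
  case zero
  then show ?case by (intro bexI[of _ 0]) (simp_all add: endo.linear_0[OF T] gen_eig.zero)
next
  case (step w)
  then obtain u where u: "u \<in> gen_eig T b" "T u - scale a u = T w - scale b w" by blast
  have w: "w \<in> gen_eig T b" by (rule gen_eig.step) (rule step.hyps)
  have "(T w - T u) - scale a (w - u) = scale (b - a) w"
    using u(2) by (simp add: algebra_simps)
  then have "scale (1 / (b - a)) ((T w - T u) - scale a (w - u)) = w"
    using \<open>a \<noteq> b\<close> by simp
  then have "T (scale (1 / (b - a)) (w - u)) - scale a (scale (1 / (b - a)) (w - u)) = w"
    by (simp only: endo.linear_scale[OF T] endo.linear_diff[OF T] scale_left_commute[of a]
        scale_right_diff_distrib[symmetric])
  moreover have "scale (1 / (b - a)) (w - u) \<in> gen_eig T b"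
    using u(1) w subspace_gen_eig[OF T] by (intro subspace_scale subspace_diff)
  ultimately show ?case by blast
qed

lemma gen_eig_independent:
  assumes T: "endo T" and "finite A" and "\<And>a. a \<in> A \<Longrightarrow> f a \<in> gen_eig T a"
    and "(\<Sum>a\<in>A. f a) = 0" and "a \<in> A"
  shows "f a = 0"
  using assms(2-)
proof (induction A arbitrary: f a rule: finite_induct)
  case (insert c A)
  have "w = 0" if "w \<in> gen_eig T c" "\<And>a. a \<in> A \<Longrightarrow> g a \<in> gen_eig T a" "w + (\<Sum>a\<in>A. g a) = 0" for w g
    using that
  proof (induction arbitrary: g)
    case (step w)
    let ?g = "\<lambda>a. T (g a) - scale c (g a)"
    have g: "?g a \<in> gen_eig T a" if "a \<in> A" for a
      using that step.prems(1) gen_eig_image[OF T] subspace_gen_eig[OF T]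
      by (intro subspace_diff subspace_scale) auto
    have "(T w - scale c w) + (\<Sum>a\<in>A. ?g a) = T (w + sum g A) - scale c (w + sum g A)"
      by (simp add: endo.linear_add[OF T] endo.linear_sum[OF T] sum_subtractf scale_sum_right
          algebra_simps)
    also have "\<dots> = 0" unfolding step.prems(2) by (simp add: endo.linear_0[OF T])
    finally have sum0: "(T w - scale c w) + (\<Sum>a\<in>A. ?g a) = 0" .
    have "T w - scale c w = 0" by (rule step.IH[OF g sum0])
    then have "sum ?g A = 0" using sum0 by simp
    then have "?g a = 0" if "a \<in> A" for a
      using insert.IH[OF g] that by blast
    then have "g a = 0" if "a \<in> A" for a
      using gen_eig_inj[OF T step.prems(1)[OF that], of c] that insert.hyps by auto
    then show ?case using step.prems(2) by simp
  qed simp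
  moreover have fA: "f b \<in> gen_eig T b" if "b \<in> A" for b using insert.prems(1) that by simp
  moreover have sum0: "f c + sum f A = 0" using insert.prems(2) insert.hyps by simp
  ultimately have "f c = 0" using insert.prems(1)[of c] by blast
  then show ?case using insert.IH[OF fA] sum0 insert.prems(3) by auto
qed simp

lemma gen_eig_imp_eigenvector:
  assumes "v \<in> gen_eig T a" "v \<noteq> 0"
  shows "\<exists>u. u \<noteq> 0 \<and> T u = scale a u"
  using assms by induction auto

text \<open>
  Modulo the sum \<open>S\<close> of the generalised eigenspaces, \<open>T\<close> has no eigenvector: the component of
  \<open>(T - a) v\<close> for \<open>b \<noteq> a\<close> can be lifted along \<open>T - a\<close>, which is surjective on the generalised
  eigenspace for \<open>b\<close>.
\<close>

lemma gen_eig_span_step: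
  assumes T: "endo T" and v: "T v - scale a v \<in> span (\<Union>a. gen_eig T a)"
  shows "v \<in> span (\<Union>a. gen_eig T a)"
proof -
  let ?S = "span (\<Union>a. gen_eig T a)"
  let ?P = "\<lambda>w. \<exists>u\<in>?S. w - (T u - scale a u) \<in> gen_eig T a"
  have "?P (T v - scale a v)"
    using v
  proof (induction rule: span_induct_alt)
    case base
    show ?case by (intro bexI[of _ 0] span_zero) (simp add: endo.linear_0[OF T] gen_eig.zero)
  next
    case (step c x y)
    from step(1) obtain b where b: "x \<in> gen_eig T b" by blast
    from step(2) obtain u where u: "u \<in> ?S" "y - (T u - scale a u) \<in> gen_eig T a" by blast
    show ?case
    proof (cases "b = a")
      case True
      then have "scale c x + (y - (T u - scale a u)) \<in> gen_eig T a"
        using b u subspace_gen_eig[OF T] by (intro subspace_add subspace_scale) auto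
      then show ?thesis using u(1) by (intro bexI[of _ u]) (auto simp: algebra_simps)
    next
      case False
      with b obtain t where t: "t \<in> gen_eig T b" "T t - scale a t = x"
        using gen_eig_surj[OF T, of x b a] by metis
      have "scale c t + u \<in> ?S"
        using t(1) u(1) by (intro span_add span_scale) (auto intro: span_base)
      moreover have "scale c x + y - (T (scale c t + u) - scale a (scale c t + u))
          = y - (T u - scale a u)"
        unfolding t(2)[symmetric]
        by (simp add: endo.linear_add[OF T] endo.linear_scale[OF T] scale_left_commute algebra_simps)
      ultimately show ?thesis using u(2) by metis
    qed
  qed
  then obtain u where u: "u \<in> ?S" "(T v - scale a v) - (T u - scale a u) \<in> gen_eig T a" by blast
  have "v - u \<in> gen_eig T a"
    by (rule gen_eig.step) (use u(2) in \<open>simp add: endo.linear_diff[OF T] algebra_simps\<close>)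
  then have "v - u \<in> ?S" by (auto intro: span_base)
  from span_add[OF this u(1)] show ?thesis by simp
qed

definition poly_act :: "('b \<Rightarrow> 'b) \<Rightarrow> 'a poly \<Rightarrow> 'b \<Rightarrow> 'b"
  where "poly_act T p v = (\<Sum>i\<le>degree p. scale (coeff p i) ((T ^^ i) v))"

lemma poly_act_bound:
  assumes "degree p \<le> n"
  shows "poly_act T p v = (\<Sum>i\<le>n. scale (coeff p i) ((T ^^ i) v))"
  unfolding poly_act_def using assms
  by (intro sum.mono_neutral_left) (auto simp: coeff_eq_0)

lemma poly_act_0 [simp]: "poly_act T 0 v = 0"
  by (simp add: poly_act_def)

lemma poly_act_pCons: "poly_act T (pCons a p) v = scale a v + poly_act T p (T v)"
proof -
  have "poly_act T (pCons a p) v = (\<Sum>i\<le>Suc (degree p). scale (coeff (pCons a p) i) ((T ^^ i) v))"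
    by (rule poly_act_bound) (rule degree_pCons_le)
  also have "\<dots> = scale a v + poly_act T p (T v)"
    by (subst sum.atMost_Suc_shift) (simp add: poly_act_def funpow_swap1)
  finally show ?thesis .
qed

lemma poly_act_add: "poly_act T (p + q) v = poly_act T p v + poly_act T q v"
proof -
  let ?n = "max (degree p) (degree q)"
  have "degree (p + q) \<le> ?n" by (rule degree_add_le_max)
  then show ?thesis
    by (simp add: poly_act_bound[of _ ?n] scale_left_distrib sum.distrib)
qed

lemma poly_act_smult: "poly_act T (smult c p) v = scale c (poly_act T p v)"
  by (simp add: poly_act_bound[of _ "degree p"] scale_sum_right)

lemma poly_act_linear_factor:
  assumes T: "endo T"
  shows "poly_act T ([:- a, 1:] * p) v = poly_act T p (T v - scale a v)"
proof -
  have lin: "poly_act T p (x + scale c y) = poly_act T p x + scale c (poly_act T p y)" for x y c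
    by (induction p arbitrary: x y)
      (simp_all add: poly_act_pCons endo.linear_add[OF T] endo.linear_scale[OF T]
        scale_right_distrib scale_left_commute algebra_simps)
  have "[:- a, 1:] * p = smult (- a) p + pCons 0 p" by simp
  then have "poly_act T ([:- a, 1:] * p) v = scale (- a) (poly_act T p v) + poly_act T p (T v)"
    by (simp only: poly_act_add poly_act_smult poly_act_pCons scale_zero_left add_0_left)
  also have "\<dots> = poly_act T p (T v + scale (- a) v)" unfolding lin by simp
  finally show ?thesis by simp
qed

end

context fd_linear_operators
begin

lemma exists_annihilating_poly: "\<exists>p. p \<noteq> 0 \<and> poly_act T p v = 0"
proof -
  define P where "P n = (\<lambda>i. (T ^^ i) v) ` {..<n}" for n
  have "\<exists>n. (T ^^ n) v \<in> span (P n)"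
  proof (rule ccontr)
    assume "\<not> (\<exists>n. (T ^^ n) v \<in> span (P n))"
    then have no: "(T ^^ n) v \<notin> span (P n)" for n by blast
    have "independent (P n) \<and> card (P n) = n" for n
    proof (induction n)
      case 0
      show ?case by (simp add: P_def independent_empty)
    next
      case (Suc n)
      have eq: "P (Suc n) = insert ((T ^^ n) v) (P n)" by (simp add: P_def lessThan_Suc)
      have "(T ^^ n) v \<notin> P n" using no span_base by blast
      moreover have "finite (P n)" by (simp add: P_def)
      ultimately show ?case
        unfolding eq using Suc independent_insertI[OF no[of n]] by simp
    qed
    then have "card (P (Suc dimension)) \<le> dimension" "card (P (Suc dimension)) = Suc dimension"
      using independent_card_le_dim[of "P (Suc dimension)" UNIV] by (auto simp: dimension_def dim_UNIV)
    then show False by simp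
  qed
  then obtain n where n: "(T ^^ n) v \<in> span (P n)" by blast
  have "span (P n) \<subseteq> {poly_act T q v | q. q = 0 \<or> degree q < n}"
  proof (rule span_minimal)
    show "P n \<subseteq> {poly_act T q v | q. q = 0 \<or> degree q < n}"
    proof
      fix x assume "x \<in> P n"
      then obtain i where i: "i < n" "x = (T ^^ i) v" by (auto simp: P_def)
      have "poly_act T (monom 1 i) v = (\<Sum>j\<le>i. if i = j then (T ^^ j) v else 0)"
        unfolding poly_act_def degree_monom_eq[OF one_neq_zero]
        by (intro sum.cong) (auto simp: coeff_monom)
      then have "x = poly_act T (monom 1 i) v" using i by simp
      moreover have "degree (monom (1::'a) i) < n" using i by (simp add: degree_monom_eq)
      ultimately show "x \<in> {poly_act T q v | q. q = 0 \<or> degree q < n}" by blast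
    qed
    show "subspace {poly_act T q v | q. q = 0 \<or> degree q < n}"
    proof (rule subspaceI)
      show "0 \<in> {poly_act T q v | q. q = 0 \<or> degree q < n}" by (auto intro: exI[of _ 0])
    next
      fix x y
      assume "x \<in> {poly_act T q v | q. q = 0 \<or> degree q < n}"
        and "y \<in> {poly_act T q v | q. q = 0 \<or> degree q < n}"
      then obtain p q where pq: "x = poly_act T p v" "p = 0 \<or> degree p < n"
        "y = poly_act T q v" "q = 0 \<or> degree q < n" by auto
      have "p + q = 0 \<or> degree (p + q) < n"
        using pq(2,4) degree_add_less[of p n q] by auto
      moreover have "x + y = poly_act T (p + q) v" by (simp add: pq(1,3) poly_act_add)
      ultimately show "x + y \<in> {poly_act T q v | q. q = 0 \<or> degree q < n}" by blast
    next
      fix c x assume "x \<in> {poly_act T q v | q. q = 0 \<or> degree q < n}"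
      then obtain p where p: "x = poly_act T p v" "p = 0 \<or> degree p < n" by auto
      have "smult c p = 0 \<or> degree (smult c p) < n" using p(2) by auto
      moreover have "scale c x = poly_act T (smult c p) v" by (simp add: p(1) poly_act_smult)
      ultimately show "scale c x \<in> {poly_act T q v | q. q = 0 \<or> degree q < n}" by blast
    qed
  qed
  with n obtain q where q: "(T ^^ n) v = poly_act T q v" "q = 0 \<or> degree q < n" by blast
  have "poly_act T (monom 1 n) v = (\<Sum>j\<le>n. if n = j then (T ^^ j) v else 0)"
    unfolding poly_act_def degree_monom_eq[OF one_neq_zero]
    by (intro sum.cong) (auto simp: coeff_monom)
  then have "poly_act T (monom 1 n + smult (- 1) q) v = 0"
    unfolding poly_act_add poly_act_smult by (simp add: q(1))
  moreover have "coeff (monom 1 n + smult (- 1) q) n = 1"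
    using q(2) by (auto simp: coeff_monom coeff_eq_0)
  then have "monom 1 n + smult (- 1) q \<noteq> 0" by force
  ultimately show ?thesis by blast
qed

text \<open>
  For a nilpotent operator the chain of the subspaces \<open>f\<^sup>n V\<close> ends in zero, and the trace does not
  change along it.
\<close>

lemma tr_nilpotent:
  assumes f: "endo f" and nil: "\<And>v. v \<in> gen_eig f 0"
  shows "tr f = 0"
proof -
  have f0: "f 0 = 0" by (rule endo.linear_0[OF f])
  have pow: "endo (f ^^ n)" for n
    by (induction n) (auto intro!: endoI simp: endo.linear_add[OF f] endo.linear_scale[OF f]
        Vector_Spaces.linear_iff vector_space_axioms)
  have pow0: "(f ^^ n) 0 = 0" for n by (induction n) (simp_all add: f0)
  have ex: "\<exists>n. (f ^^ n) v = 0" for v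
    using nil[of v]
  proof induction
    case (step v)
    then obtain n where "(f ^^ n) (f v) = 0" by auto
    then have "(f ^^ Suc n) v = 0" by (simp add: funpow_swap1)
    then show ?case by blast
  qed (auto intro: exI[of _ 0])
  then obtain m where m: "(f ^^ m v) v = 0" for v by metis
  define n where "n = Max (m ` Basis)"
  have "(f ^^ n) b = 0" if "b \<in> Basis" for b
  proof -
    have "m b \<le> n" unfolding n_def using that finite_Basis by auto
    then have "(f ^^ n) b = (f ^^ (n - m b)) ((f ^^ m b) b)"
      by (metis comp_apply funpow_add le_add_diff_inverse2)
    then show ?thesis using m pow0 by simp
  qed
  then have zero: "(f ^^ n) x = 0" for x
    using endo.linear_eq_on_span[OF pow[of n] endo.linear_zero, of Basis x] span_Basis by simp
  have chain: "\<exists>C. finite C \<and> independent C \<and> span C = range (f ^^ k) \<and> tr f = trace C f" for k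
  proof (induction k)
    case 0
    show ?case using finite_Basis independent_Basis span_Basis by (intro exI[of _ Basis]) auto
  next
    case (Suc k)
    then obtain C where C: "finite C" "independent C" "span C = range (f ^^ k)" "tr f = trace C f"
      by blast
    have sub: "subspace (range (f ^^ Suc k))"
      by (rule endo.linear_subspace_image[OF pow subspace_UNIV])
    obtain C' where C': "C' \<subseteq> range (f ^^ Suc k)" "independent C'" "range (f ^^ Suc k) \<subseteq> span C'"
      using maximal_independent_subset by metis
    have eq: "span C' = range (f ^^ Suc k)" using C'(1,3) sub span_minimal by blast
    have "trace C f = trace C' f"
    proof (rule trace_restrict[OF f C(1,2) finiteI_independent[OF C'(2)] C'(2)])
      show "f ` span C \<subseteq> span C'" unfolding eq C(3) by auto
      show "span C' \<subseteq> span C" unfolding eq C(3) by (auto simp: funpow_swap1)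
    qed
    then show ?case using C(4) C'(2) finiteI_independent[OF C'(2)] eq by auto
  qed
  then obtain C where C: "independent C" "span C = range (f ^^ n)" "tr f = trace C f" by blast
  have "C \<subseteq> {0}" using span_superset[of C] unfolding C(2) by (auto simp: zero)
  moreover have "0 \<notin> C" using C(1) dependent_zero by blast
  ultimately have "C = {}" by blast
  then show ?thesis using C(3) by (simp add: trace_def)
qed

end

locale alg_closed_linear_operators = fd_linear_operators scale Basis
  for scale :: "'k::alg_closed_field \<Rightarrow> 'g::ab_group_add \<Rightarrow> 'g" and Basis
begin

text \<open>
  If a polynomial in \<open>T\<close> annihilates \<open>v\<close> modulo the sum of the generalised eigenspaces, its linear
  factors can be removed one at a time.
\<close>

lemma span_gen_eig:
  assumes T: "endo T"
  shows "span (\<Union>a. gen_eig T a) = UNIV"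
proof -
  let ?S = "span (\<Union>a. gen_eig T a)"
  have "v \<in> ?S" if "p \<noteq> 0" "poly_act T p v \<in> ?S" for p v
    using that
  proof (induction "degree p" arbitrary: p v)
    case 0
    then have "scale (coeff p 0) v \<in> ?S" by (simp add: poly_act_def)
    moreover have "coeff p 0 \<noteq> 0"
      using 0 leading_coeff_neq_0[of p] by metis
    ultimately show ?case using span_scale[of "scale (coeff p 0) v" _ "1 / coeff p 0"] by simp
  next
    case (Suc n)
    then obtain a where "poly p a = 0" using alg_closed_imp_poly_has_root[of p] by auto
    then obtain q where q: "p = [:- a, 1:] * q" by (auto simp: poly_eq_0_iff_dvd)
    then have "q \<noteq> 0" using Suc by auto
    then have "degree p = Suc (degree q)" unfolding q by (subst degree_mult_eq) auto
    then have "n = degree q" using Suc.hyps(2) by simp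
    moreover have "poly_act T q (T v - scale a v) \<in> ?S"
      using Suc.prems(2) unfolding q poly_act_linear_factor[OF T] .
    ultimately have "T v - scale a v \<in> ?S"
      using Suc.hyps(1) \<open>q \<noteq> 0\<close> by blast
    then show ?case by (rule gen_eig_span_step[OF T])
  qed
  moreover have "0 \<in> ?S" by (rule span_zero)
  ultimately show ?thesis using exists_annihilating_poly by (metis UNIV_eq_I)
qed

lemma nilpotent_if_no_eigenvalue:
  assumes T: "endo T" and "\<And>a u. T u = scale a u \<Longrightarrow> u \<noteq> 0 \<Longrightarrow> a = 0"
  shows "v \<in> gen_eig T 0"
proof -
  have "gen_eig T a \<subseteq> gen_eig T 0" for a
    using gen_eig_imp_eigenvector[of _ T a] assms(2) gen_eig.zero[of T 0] by blast
  then have "span (\<Union>a. gen_eig T a) \<subseteq> gen_eig T 0"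
    by (intro span_minimal subspace_gen_eig[OF T]) auto
  then show ?thesis using span_gen_eig[OF T] by auto
qed

text \<open>
  In a basis of generalised eigenvectors, any function of the eigenvalues gives an operator
  \<open>\<delta>\<close>. The operator \<open>T \<circ> \<delta>\<close> differs by a nilpotent operator from the one that multiplies the
  generalised eigenspace for \<open>a\<close> by \<open>a * \<phi> a\<close>.
\<close>

lemma gen_eig_functional_calculus:
  assumes T: "endo T"
  obtains C wt where "finite C" "span C = UNIV" "\<And>b. b \<in> C \<Longrightarrow> b \<in> gen_eig T (wt b)"
    and "\<And>\<phi>. \<exists>\<delta>. endo \<delta> \<and> (\<forall>a. \<forall>v\<in>gen_eig T a. \<delta> v = scale (\<phi> a) v) \<and>
      tr (\<lambda>x. T (\<delta> x)) = (\<Sum>b\<in>C. wt b * \<phi> (wt b))"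
proof -
  obtain C where C: "C \<subseteq> (\<Union>a. gen_eig T a)" "independent C" "(\<Union>a. gen_eig T a) \<subseteq> span C"
    using maximal_independent_subset by metis
  have fin: "finite C" by (rule finiteI_independent[OF C(2)])
  have span: "span C = UNIV"
    using span_mono[OF C(3)] unfolding span_gen_eig[OF T] span_span by auto
  have "\<forall>b\<in>C. \<exists>a. b \<in> gen_eig T a" using C(1) by blast
  then obtain wt where wt: "b \<in> gen_eig T (wt b)" if "b \<in> C" for b by metis
  define act where "act \<phi> = endo.construct C (\<lambda>b. scale (\<phi> (wt b)) b)" for \<phi> :: "'k \<Rightarrow> 'k"
  have act: "endo (act \<phi>)" for \<phi>
    unfolding act_def by (rule endo.linear_construct[OF C(2)])
  have act_base: "act \<phi> b = scale (\<phi> (wt b)) b" if "b \<in> C" for \<phi> b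
    unfolding act_def by (rule endo.construct_basis[OF C(2) that])
  have act_eig: "act \<phi> v = scale (\<phi> a) v" if v: "v \<in> gen_eig T a" for \<phi> a v
  proof -
    let ?A = "insert a (wt ` C)"
    define r where "r = representation C v"
    define g where "g c = (\<Sum>b\<in>{b \<in> C. wt b = c}. scale (r b) b)" for c
    have g: "g c \<in> gen_eig T c" for c
      unfolding g_def using wt subspace_gen_eig[OF T]
      by (intro subspace_sum subspace_scale) auto
    have "v = (\<Sum>b\<in>C. scale (r b) b)"
      unfolding r_def by (rule sum_representation_eq[symmetric]) (auto simp: C(2) span fin)
    also have "\<dots> = (\<Sum>c\<in>?A. g c)"
      unfolding g_def by (rule sum.group[symmetric]) (use fin in auto)
    finally have vg: "v = (\<Sum>c\<in>?A. g c)" .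
    have "(\<Sum>c\<in>?A. g c - (if c = a then v else 0)) = 0"
      using vg fin by (simp add: sum_subtractf)
    moreover have "g c - (if c = a then v else 0) \<in> gen_eig T c" for c
      using g[of c] v subspace_gen_eig[OF T] by (auto intro: subspace_diff)
    ultimately have zero: "g c - (if c = a then v else 0) = 0" if "c \<in> ?A" for c
      using gen_eig_independent[OF T, of ?A "\<lambda>c. g c - (if c = a then v else 0)" c] fin that by auto
    have act_g: "act \<phi> (g c) = scale (\<phi> c) (g c)" for c
      unfolding g_def endo.linear_sum[OF act] scale_sum_right
      by (intro sum.cong refl) (auto simp: endo.linear_scale[OF act] act_base mult.commute)
    have "g a = v" using zero[of a] by simp
    then show ?thesis using act_g[of a] by simp
  qed
  have trace: "tr (\<lambda>x. T (act \<phi> x)) = (\<Sum>b\<in>C. wt b * \<phi> (wt b))" for \<phi>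
  proof -
    let ?\<psi> = "\<lambda>a. a * \<phi> a"
    let ?N = "\<lambda>x. T (act \<phi> x) - act ?\<psi> x"
    have N: "endo ?N"
      by (rule endoI) (simp_all add: endo.linear_add[OF act] endo.linear_scale[OF act]
          endo.linear_add[OF T] endo.linear_scale[OF T] scale_right_diff_distrib)
    have N_eig: "?N v = scale (\<phi> a) (T v - scale a v)" if "v \<in> gen_eig T a" for a v
      by (simp add: act_eig[OF that] endo.linear_scale[OF T] scale_right_diff_distrib mult.commute)
    have "v \<in> gen_eig ?N 0" if "v \<in> gen_eig T a" for a v
      using that
    proof induction
      case (step v)
      have "v \<in> gen_eig T a" by (rule gen_eig.step[OF step.hyps])
      then have "?N v \<in> gen_eig ?N 0"
        unfolding N_eig[OF \<open>v \<in> gen_eig T a\<close>]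
        by (intro subspace_scale[OF subspace_gen_eig[OF N]] step.IH)
      then have "?N v - scale 0 v \<in> gen_eig ?N 0" by simp
      then show ?case by (rule gen_eig.step)
    qed (rule gen_eig.zero)
    then have "span (\<Union>a. gen_eig T a) \<subseteq> gen_eig ?N 0"
      by (intro span_minimal subspace_gen_eig[OF N]) auto
    then have "tr ?N = 0" using span_gen_eig[OF T] by (intro tr_nilpotent[OF N]) auto
    then have "tr (\<lambda>x. T (act \<phi> x)) = tr (act ?\<psi>)" by (simp add: tr_diff)
    also have "\<dots> = trace C (act ?\<psi>)" by (rule tr_basis_independent[OF act C(2) span])
    also have "\<dots> = (\<Sum>b\<in>C. wt b * \<phi> (wt b))"
      unfolding trace_def using act_base
      by (intro sum.cong)
        (auto simp: representation_scale[OF C(2)] representation_basis[OF C(2)] span_base)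
    finally show ?thesis .
  qed
  show thesis
    by (rule that[OF fin span wt]) (use act act_eig trace in blast)+
qed

end

context fd_linear_operators
begin

text \<open>
  A symmetric bilinear form identifies its quotient by the radical with its dual. The operator \<open>T\<close>
  below is the form in the coordinates of a basis that extends a basis of the radical, made
  injective by the identity on the radical.
\<close>

lemma functional_represented_by_form:
  fixes \<beta> :: "'b \<Rightarrow> 'b \<Rightarrow> 'a"
  assumes add: "\<And>x y z. \<beta> (x + y) z = \<beta> x z + \<beta> y z"
    and scale: "\<And>c x z. \<beta> (scale c x) z = c * \<beta> x z"
    and sym: "\<And>x y. \<beta> x y = \<beta> y x"
    and \<phi>: "Vector_Spaces.linear scale (*) \<phi>"
    and \<phi>_rad: "\<And>x. (\<And>y. \<beta> x y = 0) \<Longrightarrow> \<phi> x = 0"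
  shows "\<exists>w. \<forall>x. \<beta> w x = \<phi> x"
proof -
  interpret \<phi>: Vector_Spaces.linear scale "(*)" \<phi> by fact
  have lin: "Vector_Spaces.linear scale (*) (\<beta> w)" for w
    using add[of _ _ w] scale[of _ _ w] vector_space_axioms \<phi>.vs2.vector_space_axioms
    by (simp add: Vector_Spaces.linear_iff sym[of w])
  define rad where "rad = {x. \<forall>y. \<beta> x y = 0}"
  obtain R where R: "R \<subseteq> rad" "independent R" "rad \<subseteq> span R"
    using maximal_independent_subset by metis
  obtain D where D: "R \<subseteq> D" "D \<subseteq> UNIV" "independent D" "UNIV \<subseteq> span D"
    using maximal_independent_subset_extend[OF subset_UNIV R(2)] by metis
  have spanD: "span D = UNIV" using D(4) by auto
  have fin: "finite D" by (rule finiteI_independent[OF D(3)])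
  define co where "co w b = (if b \<in> R then representation D w b else \<beta> w b)" for w b
  define T where "T w = (\<Sum>b\<in>D. scale (co w b) b)" for w
  have coord: "c b = d b"
    if "(\<Sum>b\<in>D. scale (c b) b) = (\<Sum>b\<in>D. scale (d b) b)" "b \<in> D" for c d b
  proof -
    have "(\<Sum>b\<in>D. scale (c b - d b) b) = 0"
      using that by (simp add: scale_left_diff_distrib sum_subtractf)
    from independentD[OF D(3) fin subset_refl this that(2)] show ?thesis by simp
  qed
  have T: "endo T"
  proof (rule endoI)
    have "co (x + y) b = co x b + co y b" for x y b
      by (simp add: co_def add representation_add[OF D(3)] spanD)
    then show "T (x + y) = T x + T y" for x y
      by (simp add: T_def scale_left_distrib sum.distrib)
    have "co (scale c x) b = c * co x b" for c x b
      by (simp add: co_def scale representation_scale[OF D(3)] spanD)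
    then show "T (scale c x) = scale c (T x)" for c x
      by (simp add: T_def scale_sum_right)
  qed
  have "w = 0" if "T w = 0" for w
  proof -
    have co0: "co w b = 0" if "b \<in> D" for b
      using coord[of "co w" "\<lambda>b. 0"] \<open>T w = 0\<close> that by (simp add: T_def)
    have "\<beta> w b = 0" if "b \<in> D" for b
    proof (cases "b \<in> R")
      case True
      then show ?thesis using R(1) sym[of w b] by (auto simp: rad_def)
    qed (use co0[OF that] in \<open>simp add: co_def\<close>)
    then have "\<beta> w x = 0" for x
      using module_hom.eq_0_on_span[OF Vector_Spaces.linear.axioms(3)[OF lin], of D w x] spanD by auto
    then have "w \<in> span R" using R(3) by (auto simp: rad_def)
    then have rep: "representation D w = representation R w"
      by (rule representation_extend[OF D(3) _ D(1)])
    have "representation D w b = 0" for b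
    proof (cases "b \<in> R")
      case True
      then show ?thesis using co0[of b] D(1) by (auto simp: co_def)
    next
      case False
      then show ?thesis using representation_ne_zero[of R w b] unfolding rep by blast
    qed
    then show ?thesis
      using sum_representation_eq[OF D(3), of w D] fin spanD by simp
  qed
  then have "inj T" using endo.linear_inj_iff_eq_0[OF T] by blast
  then have "surj T" by (rule linear_inj_imp_surj[OF T])
  then obtain w where w: "T w = (\<Sum>b\<in>D. scale (if b \<in> R then 0 else \<phi> b) b)" by (metis surjD)
  have "\<beta> w b = \<phi> b" if "b \<in> D" for b
  proof (cases "b \<in> R")
    case True
    then have "\<And>y. \<beta> b y = 0" using R(1) by (auto simp: rad_def)
    then show ?thesis using \<phi>_rad sym by metis
  next
    case False
    then show ?thesis
      using coord[OF w[unfolded T_def] that] by (simp add: co_def)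
  qed
  then have "\<beta> w x = \<phi> x" for x
    using vector_space_pair.linear_eq_on_span[OF vector_space_pair.intro lin \<phi>, of D w x]
      vector_space_axioms \<phi>.vs2.vector_space_axioms spanD by auto
  then show ?thesis by blast
qed

end

lemma exists_rat_linear_functional:
  fixes a :: "'k::field_char_0"
  assumes "a \<noteq> 0"
  obtains \<phi> :: "'k \<Rightarrow> rat"
  where "\<And>x y. \<phi> (x + y) = \<phi> x + \<phi> y" "\<And>q x. \<phi> (of_rat q * x) = q * \<phi> x" "\<phi> a \<noteq> 0"
proof -
  interpret K: vector_space "\<lambda>q x. of_rat q * (x::'k)"
    by unfold_locales (simp_all add: algebra_simps of_rat_add of_rat_mult)
  interpret Q: vector_space "(*) :: rat \<Rightarrow> rat \<Rightarrow> rat"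
    by unfold_locales (simp_all add: algebra_simps)
  interpret P: vector_space_pair "\<lambda>q x. of_rat q * (x::'k)" "(*) :: rat \<Rightarrow> rat \<Rightarrow> rat" ..
  have "K.independent {a}" using assms by (simp add: K.dependent_single)
  from P.linear_independent_extend[OF this, of "\<lambda>x. 1"] obtain \<phi>
    where \<phi>: "Vector_Spaces.linear (\<lambda>q x. of_rat q * (x::'k)) (*) \<phi>" "\<phi> a = (1::rat)"
    by auto
  show thesis
    using P.linear_add[OF \<phi>(1)] P.linear_scale[OF \<phi>(1)] \<phi>(2) by (intro that[of \<phi>]) auto
qed

section \<open>The Killing form of a reductive Lie algebra\<close>

locale fd_lie_algebra = lie_algebra scale bracket + alg_closed_linear_operators scale Basis
  for scale :: "'k::{alg_closed_field, field_char_0} \<Rightarrow> 'g::ab_group_add \<Rightarrow> 'g"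
    and bracket :: "'g \<Rightarrow> 'g \<Rightarrow> 'g" and Basis :: "'g set"
begin

lemma bracket_diff_left: "bracket (x - y) z = bracket x z - bracket y z"
  using bracket_add_left[of x "- y" z] by (simp add: bracket_minus_left)

lemma bracket_diff_right: "bracket x (y - z) = bracket x y - bracket x z"
  using bracket_add_right[of x y "- z"] by (simp add: bracket_minus_right)

lemma bracket_bracket: "bracket (bracket x y) z = bracket x (bracket y z) - bracket y (bracket x z)"
  using bracket_leibniz[of x y z] by simp

lemma endo_bracket: "endo (bracket x)"
  by (rule endoI) (simp_all add: bracket_add_right bracket_scale_right)

lemma endo_comp: "endo f \<Longrightarrow> endo g \<Longrightarrow> endo (\<lambda>x. f (g x))"
  using Vector_Spaces.linear_compose[of scale scale g scale f] by (simp add: comp_def)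

definition killing :: "'g \<Rightarrow> 'g \<Rightarrow> 'k"
  where "killing x y = tr (\<lambda>v. bracket x (bracket y v))"

lemma killing_commute: "killing x y = killing y x"
  unfolding killing_def by (rule tr_commute[OF endo_bracket endo_bracket])

lemma killing_add_left: "killing (x + y) z = killing x z + killing y z"
  by (simp add: killing_def bracket_add_left tr_add)

lemma killing_add_right: "killing z (x + y) = killing z x + killing z y"
  by (simp add: killing_commute[of z] killing_add_left)

lemma killing_scale_left: "killing (scale c x) z = c * killing x z"
  by (simp add: killing_def bracket_scale_left tr_scale)

lemma killing_scale_right: "killing z (scale c x) = c * killing z x"
  by (simp add: killing_commute[of z] killing_scale_left)

lemma killing_minus_left: "killing (- x) z = - killing x z"
  by (simp add: killing_def bracket_minus_left tr_minus)

lemma killing_invariant: "killing (bracket x y) z = killing x (bracket y z)"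
proof -
  have "tr (\<lambda>v. bracket y (bracket x (bracket z v))) = tr (\<lambda>v. bracket x (bracket z (bracket y v)))"
    by (rule tr_commute[OF endo_bracket endo_comp[OF endo_bracket endo_bracket]])
  then show ?thesis
    by (simp add: killing_def bracket_bracket bracket_diff_right tr_diff)
qed

lemma killing_invariant': "killing (bracket y x) z = - killing x (bracket y z)"
  using killing_invariant[of x y z] bracket_anti[of y x] by (simp add: killing_minus_left)

definition radical :: "'g set"
  where "radical = {x. \<forall>y. killing x y = 0}"

lemma subspace_radical: "subspace radical"
  by (rule subspaceI)
    (auto simp: radical_def killing_add_left killing_scale_left killing_def[of 0] tr_zero)

lemma bracket_radical: "x \<in> radical \<Longrightarrow> bracket x y \<in> radical"
  by (simp add: radical_def killing_invariant)

lemma gen_eig_bracket: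
  assumes "u \<in> gen_eig (bracket x) a" "v \<in> gen_eig (bracket x) b"
  shows "bracket u v \<in> gen_eig (bracket x) (a + b)"
  using assms
proof (induction arbitrary: v)
  case (step u)
  note outer = step.IH
  show ?case
    using step.prems
  proof induction
    case (step v)
    have "v \<in> gen_eig (bracket x) b" by (rule gen_eig.step[OF step.hyps])
    then have "bracket (bracket x u - scale a u) v + bracket u (bracket x v - scale b v)
        \<in> gen_eig (bracket x) (a + b)"
      using outer step.IH by (intro subspace_add[OF subspace_gen_eig[OF endo_bracket]])
    also have "bracket (bracket x u - scale a u) v + bracket u (bracket x v - scale b v)
        = bracket x (bracket u v) - scale (a + b) (bracket u v)"
      by (simp add: bracket_leibniz[of x u v] bracket_diff_left bracket_diff_right
          bracket_scale_left bracket_scale_right scale_left_distrib)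
    finally show ?case by (rule gen_eig.step)
  qed (simp add: gen_eig.zero)
qed (simp add: gen_eig.zero)

text \<open>
  The argument behind Cartan's criterion. The eigenvalues of \<open>ad x\<close> are tested against the
  derivations \<open>\<delta>\<close> that multiply the generalised eigenspace for \<open>a\<close> by \<open>\<phi> a\<close>, for a
  \<open>\<rat>\<close>-linear functional \<open>\<phi>\<close>: as \<open>ad q \<circ> \<delta> - \<delta> \<circ> ad q = - ad (\<delta> q)\<close>, the trace of
  \<open>ad [p, q] \<circ> \<delta>\<close> is \<open>- killing p (\<delta> q)\<close>, hence zero for \<open>p\<close> in the radical. This trace is the sum of all
  \<open>a * \<phi> a\<close>, and \<open>\<phi>\<close> maps the sum to a sum of rational squares.
\<close>

lemma ad_nilpotent_bracket_radical:
  assumes x: "x \<in> span {bracket p q | p q. p \<in> radical}"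
  shows "v \<in> gen_eig (bracket x) 0"
proof -
  obtain C wt where C: "finite C" "span C = UNIV" "\<And>b. b \<in> C \<Longrightarrow> b \<in> gen_eig (bracket x) (wt b)"
    and calculus: "\<And>\<phi>. \<exists>\<delta>. endo \<delta> \<and>
      (\<forall>a. \<forall>v\<in>gen_eig (bracket x) a. \<delta> v = scale (\<phi> a) v) \<and>
      tr (\<lambda>v. bracket x (\<delta> v)) = (\<Sum>b\<in>C. wt b * \<phi> (wt b))"
    by (rule gen_eig_functional_calculus[OF endo_bracket[of x]]) (rule that)
  have "wt b = 0" if "b \<in> C" for b
  proof (rule ccontr)
    assume "wt b \<noteq> 0"
    then obtain \<phi> :: "'k \<Rightarrow> rat"
      where \<phi>_add: "\<And>x y. \<phi> (x + y) = \<phi> x + \<phi> y"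
        and \<phi>_scale: "\<And>q x. \<phi> (of_rat q * x) = q * \<phi> x" and \<phi>: "\<phi> (wt b) \<noteq> 0"
      using exists_rat_linear_functional by blast
    obtain \<delta> where \<delta>: "endo \<delta>"
      and \<delta>_eig: "\<And>a v. v \<in> gen_eig (bracket x) a \<Longrightarrow> \<delta> v = scale (of_rat (\<phi> a)) v"
      and \<delta>_tr: "tr (\<lambda>v. bracket x (\<delta> v)) = (\<Sum>b\<in>C. wt b * of_rat (\<phi> (wt b)))"
      using calculus[of "\<lambda>a. of_rat (\<phi> a)"] by blast
    have lin_l: "endo (\<lambda>u. \<delta> (bracket u v))" "endo (\<lambda>u. bracket (\<delta> u) v + bracket u (\<delta> v))" for v
      by (rule endoI; simp add: endo.linear_add[OF \<delta>] endo.linear_scale[OF \<delta>] bracket_add_left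
          bracket_scale_left scale_right_distrib)+
    have lin_r: "endo (\<lambda>v. \<delta> (bracket u v))" "endo (\<lambda>v. bracket (\<delta> u) v + bracket u (\<delta> v))" for u
      by (rule endoI; simp add: endo.linear_add[OF \<delta>] endo.linear_scale[OF \<delta>] bracket_add_right
          bracket_scale_right scale_right_distrib)+
    have eig: "\<delta> (bracket u v) = bracket (\<delta> u) v + bracket u (\<delta> v)"
      if "u \<in> gen_eig (bracket x) a" "v \<in> gen_eig (bracket x) b" for u v a b
      using \<delta>_eig[OF gen_eig_bracket[OF that]] \<delta>_eig[OF that(1)] \<delta>_eig[OF that(2)]
      by (simp add: bracket_scale_left bracket_scale_right \<phi>_add of_rat_add scale_left_distrib)
    have half: "\<delta> (bracket u v) = bracket (\<delta> u) v + bracket u (\<delta> v)"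
      if "v \<in> gen_eig (bracket x) b" for u v b
      using endo.linear_eq_on_span[OF lin_l(1)[of v] lin_l(2)[of v],
          of "\<Union>a. gen_eig (bracket x) a" u] eig that
        span_gen_eig[OF endo_bracket] by auto
    have derivation: "\<delta> (bracket u v) = bracket (\<delta> u) v + bracket u (\<delta> v)" for u v
      using endo.linear_eq_on_span[OF lin_r(1)[of u] lin_r(2)[of u],
          of "\<Union>a. gen_eig (bracket x) a" v] half
        span_gen_eig[OF endo_bracket] by auto
    have generator: "tr (\<lambda>v. bracket (bracket p q) (\<delta> v)) = 0" if "p \<in> radical" for p q
    proof -
      have "tr (\<lambda>v. bracket q (bracket p (\<delta> v))) = tr (\<lambda>v. bracket p (\<delta> (bracket q v)))"
        by (rule tr_commute[OF endo_bracket endo_comp[OF endo_bracket \<delta>]])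
      then have "tr (\<lambda>v. bracket (bracket p q) (\<delta> v)) =
          tr (\<lambda>v. bracket p (bracket q (\<delta> v) - \<delta> (bracket q v)))"
        by (simp add: bracket_bracket bracket_diff_right tr_diff)
      also have "\<dots> = - killing p (\<delta> q)"
        by (simp add: derivation bracket_minus_right tr_minus killing_def)
      finally show ?thesis using that by (simp add: radical_def)
    qed
    have "span {bracket p q | p q. p \<in> radical} \<subseteq> {y. tr (\<lambda>v. bracket y (\<delta> v)) = 0}"
    proof (rule span_minimal)
      show "subspace {y. tr (\<lambda>v. bracket y (\<delta> v)) = 0}"
        by (rule subspaceI)
          (simp_all add: bracket_add_left bracket_scale_left tr_add tr_scale tr_zero)
    qed (use generator in auto)
    with x have "(\<Sum>b\<in>C. of_rat (\<phi> (wt b)) * wt b) = 0"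
      using \<delta>_tr by (auto simp: mult.commute)
    moreover have "\<phi> 0 = 0" using \<phi>_scale[of 0 0] by simp
    moreover have "\<phi> (\<Sum>b\<in>C. of_rat (\<phi> (wt b)) * wt b) = (\<Sum>b\<in>C. \<phi> (wt b) * \<phi> (wt b))"
      using C(1) by induction (simp_all add: \<phi>_add \<phi>_scale \<open>\<phi> 0 = 0\<close>)
    ultimately have "(\<Sum>b\<in>C. \<phi> (wt b) * \<phi> (wt b)) = 0" by simp
    then have "\<phi> (wt b) * \<phi> (wt b) = 0"
      using sum_nonneg_eq_0_iff[OF C(1), of "\<lambda>b. \<phi> (wt b) * \<phi> (wt b)"] that by simp
    with \<phi> show False by simp
  qed
  then have "C \<subseteq> gen_eig (bracket x) 0" using C(3) by force
  then have "span C \<subseteq> gen_eig (bracket x) 0"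
    by (rule span_minimal[OF _ subspace_gen_eig[OF endo_bracket]])
  then show ?thesis using C(2) by auto
qed

text \<open>
  Engel's theorem, for the action of \<open>K\<close> on \<open>U / W\<close>: by induction a maximal proper subalgebra \<open>M\<close>
  has an invariant in \<open>K / M\<close>, so that \<open>K = k v + M\<close> and \<open>M\<close> is normalised by \<open>v\<close>. Then \<open>v\<close> acts
  nilpotently on the invariants of \<open>M\<close>.
\<close>

lemma engel:
  assumes "subspace K" "\<And>x y. x \<in> K \<Longrightarrow> y \<in> K \<Longrightarrow> bracket x y \<in> K"
    and "\<And>x v. x \<in> K \<Longrightarrow> v \<in> gen_eig (bracket x) 0"
    and "subspace W" "subspace U" "W \<subset> U"
    and "\<And>x w. x \<in> K \<Longrightarrow> w \<in> W \<Longrightarrow> bracket x w \<in> W"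
    and "\<And>x u. x \<in> K \<Longrightarrow> u \<in> U \<Longrightarrow> bracket x u \<in> U"
  shows "\<exists>u\<in>U - W. \<forall>x\<in>K. bracket x u \<in> W"
  using assms
proof (induction "dim K" arbitrary: K W U rule: less_induct)
  case less
  note K = less.prems(1-3) and WU = less.prems(4-8)
  show ?case
  proof (cases "K = {0}")
    case True
    then show ?thesis using WU(3) subspace_0[OF WU(1)] by auto
  next
    case False
    define Q where "Q M \<longleftrightarrow> subspace M \<and> (\<forall>x\<in>M. \<forall>y\<in>M. bracket x y \<in> M) \<and> M \<subset> K" for M
    have "Q {0}" using False subspace_0[OF K(1)] by (auto simp: Q_def subspace_single_0)
    moreover have "\<forall>M. Q M \<longrightarrow> dim M < Suc (dim K)"
      by (auto simp: Q_def less_Suc_eq_le intro: dim_subset)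
    ultimately obtain M where M: "Q M" and max: "\<And>M'. Q M' \<Longrightarrow> dim M' \<le> dim M"
      using ex_has_greatest_nat[of Q "{0}" dim "Suc (dim K)"] by metis
    have sub: "subspace M" and closed: "\<And>x y. x \<in> M \<Longrightarrow> y \<in> M \<Longrightarrow> bracket x y \<in> M" and MK: "M \<subset> K"
      using M by (auto simp: Q_def)
    have dim: "dim M < dim K"
      using MK sub K(1) by (intro dim_psubset) (simp add: span_eq_iff[THEN iffD2])
    have inK: "x \<in> K" if "x \<in> M" for x using MK that by blast
    have "\<exists>v\<in>K - M. \<forall>x\<in>M. bracket x v \<in> M"
      by (rule less.hyps[OF dim sub closed _ sub K(1) MK]) (use closed K inK in auto)
    then obtain v where v: "v \<in> K" "v \<notin> M" "\<And>x. x \<in> M \<Longrightarrow> bracket x v \<in> M" by blast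
    have vM: "bracket v x \<in> M" if "x \<in> M" for x
      unfolding bracket_anti[of v x] by (rule subspace_neg[OF sub v(3)[OF that]])
    define M' where "M' = {y. \<exists>c. y - scale c v \<in> M}"
    have M': "M' = span (insert v M)"
      by (simp add: M'_def span_insert span_eq_iff[THEN iffD2, OF sub])
    have "M' \<subseteq> K"
      unfolding M' using v(1) MK K(1) by (intro span_minimal) auto
    moreover have "bracket y z \<in> M'" if yz: "y \<in> M'" "z \<in> M'" for y z
    proof -
      obtain c d where cd: "y - scale c v \<in> M" "z - scale d v \<in> M"
        using yz by (auto simp: M'_def)
      have "bracket y z = bracket (y - scale c v) (z - scale d v)
          + scale d (bracket (y - scale c v) v) + scale c (bracket v (z - scale d v))"
        by (simp add: bracket_diff_left bracket_diff_right bracket_scale_left bracket_scale_right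
            bracket_self scale_right_diff_distrib algebra_simps)
      also have "\<dots> \<in> M"
        using cd closed v(3) vM sub by (intro subspace_add subspace_scale) auto
      finally show ?thesis unfolding M' by (auto intro: span_base)
    qed
    moreover have "dim M < dim M'"
      unfolding M' using v(2) sub
      by (intro dim_psubset) (auto simp: span_span span_eq_iff[THEN iffD2, OF sub] intro: span_base)
    then have "\<not> Q M'" using max[of M'] by auto
    ultimately have K_eq: "K = M'" unfolding Q_def M' by (auto simp: subspace_span)
    have "\<exists>u\<in>U - W. \<forall>x\<in>M. bracket x u \<in> W"
      by (rule less.hyps[OF dim sub closed _ WU(1,2,3)]) (use K WU inK in auto)
    then obtain u where u: "u \<in> U" "u \<notin> W" "\<forall>x\<in>M. bracket x u \<in> W" by blast
    have "u \<in> gen_eig (bracket v) 0" by (rule K(3)[OF v(1)])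
    then have "\<exists>u. u \<in> U \<and> u \<notin> W \<and> (\<forall>x\<in>M. bracket x u \<in> W) \<and> bracket v u \<in> W"
      using u
    proof induction
      case zero
      then show ?case using subspace_0[OF WU(1)] by blast
    next
      case (step u)
      show ?case
      proof (cases "bracket v u \<in> W")
        case True
        then show ?thesis using step.prems by blast
      next
        case False
        have "bracket x (bracket v u) \<in> W" if "x \<in> M" for x
          unfolding bracket_leibniz[of x v u]
          using that v(1,3) step.prems(3) WU(4) subspace_add[OF WU(1)] by blast
        then show ?thesis
          using step.IH False step.prems(1) WU(5)[OF v(1)] by simp
      qed
    qed
    then obtain u where u: "u \<in> U" "u \<notin> W" "\<And>x. x \<in> M \<Longrightarrow> bracket x u \<in> W" "bracket v u \<in> W"
      by blast
    have "bracket y u \<in> W" if y: "y \<in> K" for y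
    proof -
      obtain c where c: "y - scale c v \<in> M" using y unfolding K_eq M'_def by blast
      have "bracket (y - scale c v) u + scale c (bracket v u) \<in> W"
        using u(3)[OF c] u(4) WU(1) by (intro subspace_add subspace_scale) auto
      then show ?thesis by (simp add: bracket_diff_left bracket_scale_left)
    qed
    then show ?thesis using u by blast
  qed
qed

lemma ideal_bracket_left: "ideal I \<Longrightarrow> x \<in> I \<Longrightarrow> bracket x y \<in> I"
  using subspace_neg[of I "bracket y x"] bracket_anti[of x y] by (simp add: ideal_def)

lemma complementary_ideal:
  assumes red: reductive and I: "ideal I"
  obtains J where "ideal J" "I \<inter> J = {0}" "\<And>w. \<exists>x\<in>I. \<exists>y\<in>J. w = x + y"
proof -
  obtain J where J: "ideal J" "I \<inter> J = {0}" "{x + y | x y. x \<in> I \<and> y \<in> J} = UNIV"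
    using red[unfolded reductive_def, rule_format, OF I] by (elim exE conjE) (rule that)
  have "w \<in> {x + y | x y. x \<in> I \<and> y \<in> J}" for w unfolding J(3) by (rule UNIV_I)
  then show thesis using J(1,2) by (intro that[of J]) blast+
qed

text \<open>
  The centraliser of \<open>N\<close> is an ideal. If it were not everything, Engel's theorem would give a
  nonzero invariant of \<open>N\<close> in a complementary ideal.
\<close>

lemma ad_nilpotent_ideal_central:
  assumes red: reductive and N: "ideal N" and nil: "\<And>x v. x \<in> N \<Longrightarrow> v \<in> gen_eig (bracket x) 0"
  shows "N \<subseteq> centre"
proof -
  define A where "A = {u. \<forall>x\<in>N. bracket x u = 0}"
  have subN: "subspace N" using N by (simp add: ideal_def)
  have "ideal A"
    unfolding ideal_def
  proof (intro conjI allI ballI)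
    show "subspace A"
      by (rule subspaceI) (auto simp: A_def bracket_add_right bracket_scale_right)
    show "bracket y u \<in> A" if "u \<in> A" for y u
      using that ideal_bracket_left[OF N] by (simp add: A_def bracket_leibniz)
  qed
  then obtain J where J: "ideal J" "A \<inter> J = {0}" "\<And>w. \<exists>x\<in>A. \<exists>y\<in>J. w = x + y"
    using complementary_ideal[OF red] by metis
  have subJ: "subspace J" using J(1) by (simp add: ideal_def)
  have "J = {0}"
  proof (rule ccontr)
    assume "J \<noteq> {0}"
    then have less: "{0} \<subset> J" using subspace_0[OF subJ] by auto
    have "\<exists>u\<in>J - {0}. \<forall>x\<in>N. bracket x u \<in> {0}"
      by (rule engel[OF subN _ nil subspace_single_0 subJ less])
        (use N J(1) in \<open>auto simp: ideal_def\<close>)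
    then show False using J(2) by (auto simp: A_def)
  qed
  then have "A = UNIV" using J(3) by force
  then show ?thesis by (auto simp: A_def centre_def)
qed

lemma ideal_centre: "ideal centre"
  unfolding ideal_def
proof (intro conjI allI ballI)
  show "subspace centre"
    by (rule subspaceI) (auto simp: centre_def bracket_add_left bracket_scale_left)
  show "bracket x y \<in> centre" if "y \<in> centre" for x y
    using that bracket_anti[of x y] by (simp add: centre_def)
qed

text \<open>
  The central component of \<open>x\<close> does not contribute to the bracket, which thus lies in the ideal
  complementary to the centre.
\<close>

lemma bracket_in_centre_eq_0:
  assumes red: reductive and c: "bracket x y \<in> centre"
  shows "bracket x y = 0"
proof -
  obtain J where J: "ideal J" "centre \<inter> J = {0}" "\<And>w. \<exists>x\<in>centre. \<exists>y\<in>J. w = x + y"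
    using complementary_ideal[OF red ideal_centre] by metis
  obtain z s where x: "x = z + s" "z \<in> centre" "s \<in> J" using J(3) by blast
  have "bracket x y = bracket s y" using x by (simp add: bracket_add_left centre_def)
  then have "bracket x y \<in> J" using ideal_bracket_left[OF J(1) x(3)] by simp
  then show ?thesis using J(2) c by blast
qed

theorem radical_eq_centre:
  assumes red: reductive
  shows "radical = centre"
proof
  show "centre \<subseteq> radical"
    by (auto simp: centre_def radical_def killing_def tr_zero)
next
  let ?N = "span {bracket p q | p q. p \<in> radical}"
  have NR: "?N \<subseteq> radical"
    by (rule span_minimal[OF _ subspace_radical]) (auto intro: bracket_radical)
  have "ideal ?N"
    unfolding ideal_def
  proof (intro conjI allI ballI)
    show "bracket x y \<in> ?N" if "y \<in> ?N" for x y
    proof -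
      have "bracket y x \<in> ?N" using that NR by (intro span_base) auto
      then show ?thesis unfolding bracket_anti[of x y] by (rule span_neg)
    qed
  qed (rule subspace_span)
  then have N: "?N \<subseteq> centre"
    by (rule ad_nilpotent_ideal_central[OF red]) (rule ad_nilpotent_bracket_radical)
  show "radical \<subseteq> centre"
  proof
    fix x assume "x \<in> radical"
    then have "bracket x y \<in> ?N" for y by (intro span_base) blast
    then have "bracket x y \<in> centre" for y by (rule subsetD[OF N])
    then have "bracket x y = 0" for y by (rule bracket_in_centre_eq_0[OF red])
    then show "x \<in> centre" by (simp add: centre_def)
  qed
qed

section \<open>Regularity of \<open>e\<close> and the \<open>sl\<^sub>2\<close> argument\<close>

text \<open>
  With \<open>A = ad w\<close>, \<open>B = ad e\<close> the commutator \<open>C = B A - A B\<close> commutes with \<open>B\<close>. From \<open>B\<^sup>3 = 0\<close> one gets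
  \<open>B\<^sup>2 C = 0\<close> and then \<open>B C\<^sup>3 = 0\<close> by commuting with \<open>A\<close>. If \<open>A B u = \<lambda> u\<close> with \<open>\<lambda> \<noteq> 0\<close>, then \<open>B u\<close> is an
  eigenvector of \<open>C\<close> for \<open>\<lambda>\<close>, against \<open>B C\<^sup>3 = 0\<close>. So \<open>A B\<close> is nilpotent.
\<close>

lemma killing_eq_0_if_double_bracket_central:
  assumes nil: "\<And>x. bracket e (bracket e (bracket e x)) = 0"
    and w: "bracket e (bracket e w) \<in> centre"
  shows "killing w e = 0"
proof -
  define A where "A = bracket w"
  define B where "B = bracket e"
  define C where "C = bracket (bracket e w)"
  have lin: "endo A" "endo B" "endo C" by (simp_all add: A_def B_def C_def endo_bracket)
  note add = endo.linear_add[OF lin(1)] endo.linear_add[OF lin(2)] endo.linear_add[OF lin(3)]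
  note zero = endo.linear_0[OF lin(1)] endo.linear_0[OF lin(2)] endo.linear_0[OF lin(3)]
  note scal = endo.linear_scale[OF lin(1)] endo.linear_scale[OF lin(2)] endo.linear_scale[OF lin(3)]
  have B3: "B (B (B x)) = 0" for x using nil by (simp add: B_def)
  have BA: "B (A x) = C x + A (B x)" for x
    unfolding A_def B_def C_def by (rule bracket_leibniz)
  have BC: "B (C x) = C (B x)" for x
    using w bracket_leibniz[of e "bracket e w" x] by (simp add: B_def C_def centre_def)
  \<comment> \<open>\<open>B\<^sup>3 A - A B\<^sup>3 = 3 C B\<^sup>2\<close>, as \<open>C\<close> commutes with \<open>B\<close>.\<close>
  have CBB: "C (B (B x)) = 0" for x
  proof -
    have "B (B (B (A x))) = C (B (B x)) + C (B (B x)) + C (B (B x)) + A (B (B (B x)))"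
      by (simp add: BA BC add add.assoc)
    then have "scale 3 (C (B (B x))) = 0"
      by (simp add: B3 zero add.assoc scale_left_distrib[of 1 2 "C (B (B x))", simplified]
          scale_left_distrib[of 1 1 "C (B (B x))", simplified])
    then show ?thesis by simp
  qed
  \<comment> \<open>In \<open>C B\<^sup>2 A C = C A B\<^sup>2 C + 2 C B C\<^sup>2\<close> all terms but the last contain \<open>C B\<^sup>2 = B\<^sup>2 C = 0\<close>.\<close>
  have CCCB: "C (C (C (B x))) = 0" for x
  proof -
    have "C (B (B (A (C x)))) = C (C (C (B x))) + C (C (C (B x))) + C (A (C (B (B x))))"
      by (simp add: BA BC add add.assoc)
    then have "scale 2 (C (C (C (B x)))) = 0"
      by (simp add: CBB zero scale_left_distrib[of 1 1 "C (C (C (B x)))", simplified])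
    then show ?thesis by simp
  qed
  have eigen: "a = 0" if u: "A (B u) = scale a u" "u \<noteq> 0" for a u
  proof (rule ccontr)
    assume a: "a \<noteq> 0"
    have "scale a (B (B u)) = B (B (A (B u)))" by (simp add: u scal)
    also have "\<dots> = 0" by (simp add: BA BC add B3 CBB zero)
    finally have BBu: "B (B u) = 0" using a by simp
    have "scale a (B u) = B (A (B u))" by (simp add: u scal)
    also have "\<dots> = C (B u)" by (simp add: BA BBu zero)
    finally have CBu: "C (B u) = scale a (B u)" by simp
    have "C (C (C (B u))) = scale (a * (a * a)) (B u)" by (simp add: CBu scal)
    then have "B u = 0" using CCCB[of u] a by simp
    then show False using u a by (simp add: zero)
  qed
  have AB: "endo (\<lambda>v. A (B v))" by (rule endo_comp[OF lin(1,2)])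
  have "tr (\<lambda>v. A (B v)) = 0"
    by (rule tr_nilpotent[OF AB], rule nilpotent_if_no_eigenvalue[OF AB], rule eigen)
  then show ?thesis by (simp add: killing_def A_def B_def)
qed

text \<open>
  For a nondegenerate invariant form the image of \<open>(ad e)\<^sup>2\<close> is the orthogonal space of its
  kernel, and this kernel is orthogonal to \<open>e\<close>.
\<close>

lemma double_bracket_regular:
  assumes red: reductive and nil: "\<And>x. bracket e (bracket e (bracket e x)) = 0"
  shows "\<exists>y. e - bracket e (bracket e y) \<in> centre"
proof (rule ccontr)
  assume contra: "\<not> (\<exists>y. e - bracket e (bracket e y) \<in> centre)"
  define U where "U = {u. \<exists>y. u - bracket e (bracket e y) \<in> centre}"
  have subZ: "subspace centre" using ideal_centre by (simp add: ideal_def)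
  have U: "subspace U"
  proof (rule subspaceI)
    show "0 \<in> U" using subspace_0[OF subZ] by (auto simp: U_def intro: exI[of _ 0])
    fix x y assume "x \<in> U" "y \<in> U"
    then obtain p q where "x - bracket e (bracket e p) \<in> centre"
      "y - bracket e (bracket e q) \<in> centre" by (auto simp: U_def)
    from subspace_add[OF subZ this] show "x + y \<in> U"
      by (auto simp: U_def bracket_add_right algebra_simps intro!: exI[of _ "p + q"])
  next
    fix c x assume "x \<in> U"
    then obtain p where "x - bracket e (bracket e p) \<in> centre" by (auto simp: U_def)
    from subspace_scale[OF subZ this, of c] show "scale c x \<in> U"
      by (auto simp: U_def bracket_scale_right scale_right_diff_distrib intro!: exI[of _ "scale c p"])
  qed
  obtain D where D: "D \<subseteq> U" "independent D" "U \<subseteq> span D"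
    using maximal_independent_subset by metis
  have spanD: "span D = U" using D(1,3) U span_minimal by blast
  have "e \<notin> U" using contra by (simp add: U_def)
  then have ind: "independent (insert e D)" using D(2) spanD independent_insertI by blast
  interpret k: vector_space "(*) :: 'k \<Rightarrow> 'k \<Rightarrow> 'k"
    by unfold_locales (simp_all add: algebra_simps)
  interpret gk: vector_space_pair scale "(*) :: 'k \<Rightarrow> 'k \<Rightarrow> 'k" ..
  obtain \<phi> where \<phi>: "Vector_Spaces.linear scale (*) \<phi>"
    and \<phi>_val: "\<forall>x\<in>insert e D. \<phi> x = (if x = e then 1 else 0 :: 'k)"
    using gk.linear_independent_extend[OF ind, of "\<lambda>x. if x = e then 1 else 0"] by blast
  have "\<phi> b = 0" if "b \<in> D" for b
    using \<phi>_val that D(1) \<open>e \<notin> U\<close> by auto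
  then have \<phi>U: "\<phi> x = 0" if "x \<in> U" for x
    using gk.linear_eq_0_on_span[OF \<phi>, of D x] that spanD by blast
  have "centre \<subseteq> U" by (auto simp: U_def intro!: exI[of _ 0])
  then have "\<exists>w. \<forall>x. killing w x = \<phi> x"
    using radical_eq_centre[OF red] \<phi>U
    by (intro functional_represented_by_form killing_add_left killing_scale_left killing_commute \<phi>)
      (auto simp: radical_def)
  then obtain w where w: "\<And>x. killing w x = \<phi> x" by blast
  have "killing (bracket e (bracket e w)) y = \<phi> (bracket e (bracket e y))" for y
    by (simp add: killing_invariant' w)
  moreover have "bracket e (bracket e y) \<in> U" for y
    using subspace_0[OF subZ] by (auto simp: U_def intro!: exI[of _ y])
  ultimately have "bracket e (bracket e w) \<in> radical" using \<phi>U by (simp add: radical_def)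
  then have "killing w e = 0"
    using killing_eq_0_if_double_bracket_central[OF nil] radical_eq_centre[OF red] by blast
  then show False using w[of e] \<phi>_val by simp
qed

text \<open>
  The relation between \<open>e\<close> and \<open>f\<close> is \<open>[h, e] = 2 e\<close> modulo the centre, for \<open>h = [e, f]\<close>.
  In a representation of \<open>sl\<^sub>2\<close> the operator \<open>e f\<close> is injective on the image of \<open>e\<close>, as it
  multiplies every weight vector other than the lowest by a nonzero number. For
  \<open>(ad e)\<^sup>3 = 0\<close> this follows from the identity \<open>(ad h - 2) (ad e)\<^sup>2 = 0\<close>.
\<close>

lemma ef_injective_on_image:
  assumes nil: "\<And>x. bracket e (bracket e (bracket e x)) = 0"
    and f: "bracket e (bracket e f) + scale 2 e \<in> centre"
    and x: "bracket e (bracket f (bracket e x)) = 0"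
  shows "bracket e x = 0"
proof -
  define h where "h = bracket e f"
  define E where "E = bracket e"
  define F where "F = bracket f"
  define H where "H = bracket h"
  have lin: "endo E" "endo F" "endo H" by (simp_all add: E_def F_def H_def endo_bracket)
  note add = endo.linear_add[OF lin(1)] endo.linear_add[OF lin(2)] endo.linear_add[OF lin(3)]
  note minus = endo.linear_neg[OF lin(1)] endo.linear_neg[OF lin(2)] endo.linear_neg[OF lin(3)]
  note zero = endo.linear_0[OF lin(1)] endo.linear_0[OF lin(2)] endo.linear_0[OF lin(3)]
  note scal = endo.linear_scale[OF lin(1)] endo.linear_scale[OF lin(2)] endo.linear_scale[OF lin(3)]
  have E3: "E (E (E y)) = 0" for y using nil by (simp add: E_def)
  have EF: "E (F y) = H y + F (E y)" for y
    unfolding E_def F_def H_def h_def by (rule bracket_leibniz)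
  have EH: "E (H y) = scale (- 2) (E y) + H (E y)" for y
  proof -
    have "bracket (bracket e h) y + bracket (scale 2 e) y = 0"
      using f by (simp add: centre_def h_def bracket_add_left)
    then have "bracket (bracket e h) y = scale (- 2) (bracket e y)"
      by (simp add: bracket_scale_left eq_neg_iff_add_eq_0)
    then show ?thesis
      using bracket_leibniz[of e h y] by (simp add: E_def H_def)
  qed
  have HEE: "H (E (E y)) = scale 2 (E (E y))" for y
  proof -
    \<comment> \<open>Moving \<open>E\<^sup>3\<close> past \<open>F\<close>; both outer terms vanish.\<close>
    have "E (E (E (F y))) = scale 3 (H (E (E y))) + scale (- 6) (E (E y)) + F (E (E (E y)))"
    proof -
      have 3: "scale 3 z = z + z + z" for z
        using scale_left_distrib[of 2 1 z] scale_left_distrib[of 1 1 z] by simp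
      have "scale (- 6) z = scale (- 2) z + scale (- 2) z + scale (- 2) z" for z
        using scale_left_distrib[of "- 4" "- 2" z] scale_left_distrib[of "- 2" "- 2" z] by simp
      then show ?thesis
        by (simp only: EF EH add scal 3) (simp only: ac_simps)
    qed
    then have "scale 3 (H (E (E y))) = scale 3 (scale 2 (E (E y)))"
      by (simp add: E3 zero)
    then show ?thesis by (simp only: scale_cancel_left) simp
  qed
  have EFEx: "E (F (E x)) = 0" using x by (simp add: E_def F_def)
  have FEEx: "F (E (E x)) = - H (E x)"
    using EF[of "E x"] EFEx by (simp add: eq_neg_iff_add_eq_0 add.commute)
  have "scale 2 (E (E x)) = E (F (E (E x)))"
    using EF[of "E (E x)"] by (simp add: E3 zero HEE)
  also have "\<dots> = 0"
    unfolding FEEx by (simp add: minus EH HEE)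
  finally have EEx: "E (E x) = 0" by simp
  have "- H (E x) = 0" using FEEx unfolding EEx by (simp add: zero)
  then have HEx: "H (E x) = 0" by simp
  have "E (E (F x)) = scale (- 2) (E x)"
    by (simp add: EF add EH HEx EEx zero)
  then have "scale 2 (scale (- 2) (E x)) = scale (- 2) (H (E x))"
    using HEE[of "F x"] by (simp add: scal minus)
  then have "E x = 0" by (simp add: HEx)
  then show ?thesis by (simp add: E_def)
qed

lemma exists_functional_with_stabiliser_centraliser:
  assumes red: reductive and nil: "\<And>x. bracket e (bracket e (bracket e x)) = 0"
  shows "\<exists>\<xi>. Vector_Spaces.linear scale (*) \<xi> \<and>
    (\<forall>x. (\<forall>y. \<xi> (bracket (bracket e x) (bracket e y)) = 0) \<longrightarrow> bracket e x = 0)"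
proof -
  obtain y where y: "e - bracket e (bracket e y) \<in> centre"
    using double_bracket_regular[OF red nil] by blast
  \<comment> \<open>The factor turns \<open>e = [e, [e, y]]\<close> into \<open>[e, [e, f]] = - 2 e\<close>.\<close>
  define f where "f = scale (- 2) y"
  have "scale 2 (e - bracket e (bracket e y)) \<in> centre"
    using y ideal_centre subspace_scale by (simp add: ideal_def)
  also have "scale 2 (e - bracket e (bracket e y)) = bracket e (bracket e f) + scale 2 e"
    by (simp add: f_def bracket_scale_right scale_right_diff_distrib bracket_minus_right)
  finally have f: "bracket e (bracket e f) + scale 2 e \<in> centre" .
  interpret k: vector_space "(*) :: 'k \<Rightarrow> 'k \<Rightarrow> 'k"
    by unfold_locales (simp_all add: algebra_simps)
  have "Vector_Spaces.linear scale (*) (killing f)"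
    using vector_space_axioms k.vector_space_axioms
    by (simp add: Vector_Spaces.linear_iff killing_add_right killing_scale_right)
  moreover have "bracket e x = 0"
    if x: "\<forall>y. killing f (bracket (bracket e x) (bracket e y)) = 0" for x
  proof -
    have "killing (bracket (bracket f (bracket e x)) e) y = 0" for y
      using x by (simp add: killing_invariant)
    then have "bracket (bracket f (bracket e x)) e \<in> centre"
      using radical_eq_centre[OF red] by (auto simp: radical_def)
    then have "bracket (bracket f (bracket e x)) e = 0" by (rule bracket_in_centre_eq_0[OF red])
    then have "bracket e (bracket f (bracket e x)) = 0"
      using bracket_anti[of e "bracket f (bracket e x)"] by simp
    then show ?thesis by (rule ef_injective_on_image[OF nil f])
  qed
  ultimately show ?thesis by blast
qed

end

section \<open>Index and centre of the derived Lie algebra\<close>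

theorem theorem7p6:
  fixes scale :: "'k::{alg_closed_field, field_char_0} \<Rightarrow> 'g::ab_group_add \<Rightarrow> 'g"
    and B :: "'g set"
    and bracket :: "'g \<Rightarrow> 'g \<Rightarrow> 'g"
    and e :: 'g
    and D :: "'g \<Rightarrow> 'g"
  assumes "finite_dimensional_vector_space scale B"
    and "lie_algebra scale bracket"
    and "lie_algebra.reductive scale bracket"
    and "lie_algebra.ad bracket e ^^ 3 = (\<lambda>x. 0)"
    and "D = lie_algebra.ad bracket e ^^ 2"
  shows "lie_algebra.index scale (derived_bracket bracket D)
           = vector_space.dim scale (lie_algebra.centraliser bracket e)
         \<and> lie_algebra.centre (derived_bracket bracket D) = lie_algebra.centraliser bracket e"
proof -
  interpret g: lie_algebra scale bracket by fact
  interpret fd: finite_dimensional_vector_space scale B by fact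
  interpret g: fd_lie_algebra scale bracket B
    by (intro fd_lie_algebra.intro alg_closed_linear_operators.intro fd_linear_operators.intro
        linear_operators.intro assms(1,2) g.vector_space_axioms)
  have nil: "bracket e (bracket e (bracket e x)) = 0" for x
    using fun_cong[OF assms(4), of x] by (simp add: g.ad_def numeral_3_eq_3)
  interpret gD: lie_algebra scale "derived_bracket bracket D"
    unfolding assms(5) by (rule g.lie_algebra_derived_bracket[OF _ assms(4)]) simp
  have DB: "derived_bracket bracket D x y = scale 2 (bracket (bracket e x) (bracket e y))" for x y
    using g.scale_left_distrib[of 1 1]
    unfolding assms(5) g.derived_bracket_ad_square by simp
  obtain \<xi> where \<xi>: "Vector_Spaces.linear scale (*) \<xi>"
    and \<xi>_inj: "\<And>x. (\<forall>y. \<xi> (bracket (bracket e x) (bracket e y)) = 0) \<Longrightarrow> bracket e x = 0"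
    using g.exists_functional_with_stabiliser_centraliser[OF assms(3) nil] by blast
  have lin0: "\<eta> 0 = 0" and scal: "\<eta> (scale c x) = c * \<eta> x"
    if "Vector_Spaces.linear scale (*) \<eta>" for \<eta> :: "'g \<Rightarrow> 'k" and c x
    using that unfolding Vector_Spaces.linear_iff by (metis mult_zero_left g.scale_zero_left, metis)
  have stab: "gD.stabiliser \<xi> = g.centraliser e"
    using \<xi>_inj by (auto simp: gD.stabiliser_def g.centraliser_def DB scal[OF \<xi>] lin0[OF \<xi>])
  have sub: "g.centraliser e \<subseteq> gD.stabiliser \<eta>" if "Vector_Spaces.linear scale (*) \<eta>" for \<eta>
    by (auto simp: gD.stabiliser_def g.centraliser_def DB lin0[OF that])
  have "gD.index = g.dim (g.centraliser e)"
    unfolding gD.index_def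
  proof (rule antisym)
    show "(INF \<eta>\<in>{\<eta>. Vector_Spaces.linear scale (*) \<eta>}. g.dim (gD.stabiliser \<eta>))
        \<le> g.dim (g.centraliser e)"
      using \<xi> by (intro cINF_lower2[of _ _ \<xi>]) (auto simp: stab)
    show "g.dim (g.centraliser e)
        \<le> (INF \<eta>\<in>{\<eta>. Vector_Spaces.linear scale (*) \<eta>}. g.dim (gD.stabiliser \<eta>))"
      using \<xi> by (intro cINF_greatest fd.dim_subset sub) auto
  qed
  moreover have "gD.centre = g.centraliser e"
  proof
    show "gD.centre \<subseteq> g.centraliser e"
      unfolding stab[symmetric] by (auto simp: gD.centre_def gD.stabiliser_def lin0[OF \<xi>])
    show "g.centraliser e \<subseteq> gD.centre"
      by (auto simp: gD.centre_def g.centraliser_def DB)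
  qed
  ultimately show ?thesis by blast
qed

end
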